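(* Let $d\ge 1$. A typical compact set of $\mathcal{K}$ is locally rich, i.e. the set of those $E\in\mathcal{K}$ for which it is not true that $\mathrm{Tan}(E,x)\approx\mathcal{K}$ for all $x\in E$ is of first category in $(\mathcal{K},d_H)$.
   Context: $Q=[-1,1]^d\subset\mathbb{R}^d$ and $\mathcal{K}$ is the collection of all non-empty compact subsets of $Q$ with the Hausdorff metric $d_H$ (a compact metric space). For $E\in\mathcal{K}$, $x\in E$, $t>0$, put $T_{x,t}(E)=\{(y-x)/t:y\in E\}\cap Q$. A set $F\in\mathcal{K}$ is a tangent set of $E$ at $x\in E$ if there is a sequence $t_n\searrow 0$ with $d_H(T_{x,t_n}(E),F)\to 0$; $\mathrm{Tan}(E,x)$ is the collection of all tangent sets of $E$ at $x$. For sub-collections $\mathcal{A},\mathcal{B}\subset\mathcal{K}$ write $\mathcal{A}\lesssim\mathcal{B}$ if there is $\lambda_0>0$ such that for every $A\in\mathcal{A}$ there are $B\in\mathcal{B}$, a real number $\lambda$ with $\lambda_0<\lambda<\lambda_0^{-1}$, and vectors $a\in A$, $b\in B$ with $\lambda(A-a)=B-b$. Write $\mathcal{A}\approx\mathcal{B}$ if $\mathcal{A}\lesssim\mathcal{B}$ and $\mathcal{B}\lesssim\mathcal{A}$. A subset of a topological space is of first category if it is a countable union of sets whose closures have empty interior. *)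

theory Defs
  imports "HOL-Analysis.Analysis"
begin

definition cube :: "(real ^ 'n) set" where
  "cube = cbox (-1) 1"

definition cube_compacts :: "(real ^ 'n) set set" where
  "cube_compacts = {E. E \<noteq> {} \<and> compact E \<and> E \<subseteq> cube}"

text \<open>The value \<open>0\<close> for empty or unbounded arguments is a convention. It is needed because the
  locale \<^locale>\<open>Metric_space\<close> asks for non-negativity and symmetry on the whole type, while the real
  supremum of an empty or unbounded set is unspecified.\<close>

definition hausdorff_dist :: "'a::metric_space set \<Rightarrow> 'a set \<Rightarrow> real" where
  "hausdorff_dist A B =
     (if A \<noteq> {} \<and> B \<noteq> {} \<and> bounded A \<and> bounded B
      then max (SUP a\<in>A. infdist a B) (SUP b\<in>B. infdist b A) else 0)"

definition zoom :: "real ^ 'n \<Rightarrow> real \<Rightarrow> (real ^ 'n) set \<Rightarrow> (real ^ 'n) set" where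
  "zoom x t E = (\<lambda>y. (1 / t) *\<^sub>R (y - x)) ` E \<inter> cube"

definition tangent_sets :: "(real ^ 'n) set \<Rightarrow> real ^ 'n \<Rightarrow> (real ^ 'n) set set" where
  "tangent_sets E x =
     {F \<in> cube_compacts. \<exists>t :: nat \<Rightarrow> real. (\<forall>n. t n > 0) \<and> decseq t \<and> t \<longlonglongrightarrow> 0 \<and>
        (\<lambda>n. hausdorff_dist (zoom x (t n) E) F) \<longlonglongrightarrow> 0}"

definition coll_lesssim :: "(real ^ 'n) set set \<Rightarrow> (real ^ 'n) set set \<Rightarrow> bool" where
  "coll_lesssim \<A> \<B> \<longleftrightarrow>
     (\<exists>l0 > 0. \<forall>A\<in>\<A>. \<exists>B\<in>\<B>. \<exists>l :: real. l0 < l \<and> l < inverse l0 \<and>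
        (\<exists>a\<in>A. \<exists>b\<in>B. (\<lambda>y. l *\<^sub>R (y - a)) ` A = (\<lambda>y. y - b) ` B))"

definition coll_approx :: "(real ^ 'n) set set \<Rightarrow> (real ^ 'n) set set \<Rightarrow> bool" where
  "coll_approx \<A> \<B> \<longleftrightarrow> coll_lesssim \<A> \<B> \<and> coll_lesssim \<B> \<A>"

definition locally_rich :: "(real ^ 'n) set \<Rightarrow> bool" where
  "locally_rich E \<longleftrightarrow> (\<forall>x\<in>E. coll_approx (tangent_sets E x) cube_compacts)"

definition first_category_in :: "'a topology \<Rightarrow> 'a set \<Rightarrow> bool" where
  "first_category_in X S \<longleftrightarrow>
     (\<exists>\<N>. countable \<N> \<and>
        (\<forall>N\<in>\<N>. N \<subseteq> topspace X \<and> X interior_of (X closure_of N) = {}) \<and> S = \<Union>\<N>)"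

lemma bdd_above_infdist_image:
  assumes "bounded A" "B \<noteq> {}"
  shows "bdd_above ((\<lambda>a. infdist a B) ` A)"
proof -
  from assms obtain b where b: "b \<in> B" by blast
  from assms(1) obtain e where e: "\<And>a. a \<in> A \<Longrightarrow> dist b a \<le> e"
    using bounded_any_center by metis
  have "infdist a B \<le> e" if "a \<in> A" for a
    using infdist_le[OF b, of a] e[OF that] by (simp add: dist_commute)
  then show ?thesis by (auto simp: bdd_above_def)
qed

lemma hausdorff_dist_le_iff:
  assumes "A \<noteq> {}" "B \<noteq> {}" "bounded A" "bounded B"
  shows "hausdorff_dist A B \<le> e \<longleftrightarrow>
    (\<forall>a\<in>A. infdist a B \<le> e) \<and> (\<forall>b\<in>B. infdist b A \<le> e)"
  using assms bdd_above_infdist_image[of A B] bdd_above_infdist_image[of B A]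
  by (simp add: hausdorff_dist_def cSUP_le_iff)

lemma hausdorff_dist_commute: "hausdorff_dist A B = hausdorff_dist B A"
  by (auto simp: hausdorff_dist_def max.commute)

lemma hausdorff_dist_nonneg: "0 \<le> hausdorff_dist A B"
proof (cases "A \<noteq> {} \<and> B \<noteq> {} \<and> bounded A \<and> bounded B")
  case True
  then obtain a where "a \<in> A" by blast
  moreover have "\<forall>a\<in>A. infdist a B \<le> hausdorff_dist A B"
    using True hausdorff_dist_le_iff[of A B "hausdorff_dist A B"] by blast
  ultimately show ?thesis using infdist_nonneg order_trans by blast
qed (auto simp: hausdorff_dist_def)

lemma infdist_triangle_hausdorff_dist:
  assumes "B \<noteq> {}" "C \<noteq> {}" "bounded B" "bounded C"
  shows "infdist a C \<le> infdist a B + hausdorff_dist B C"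
proof -
  have "infdist a C - hausdorff_dist B C \<le> dist a b" if "b \<in> B" for b
    using infdist_triangle[of a C b] that assms
      hausdorff_dist_le_iff[of B C "hausdorff_dist B C"] by fastforce
  then have "infdist a C - hausdorff_dist B C \<le> infdist a B"
    using assms(1) by (simp add: infdist_def cINF_greatest)
  then show ?thesis by simp
qed

lemma Metric_space_cube_compacts:
  "Metric_space (cube_compacts :: (real ^ 'n) set set) hausdorff_dist"
proof
  fix A B :: "(real ^ 'n) set"
  show "0 \<le> hausdorff_dist A B" by (rule hausdorff_dist_nonneg)
  show "hausdorff_dist A B = hausdorff_dist B A" by (rule hausdorff_dist_commute)
next
  fix A B :: "(real ^ 'n) set"
  assume "A \<in> cube_compacts" "B \<in> cube_compacts"
  then have *: "A \<noteq> {}" "B \<noteq> {}" "bounded A" "bounded B" "closed A" "closed B"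
    by (auto simp: cube_compacts_def compact_imp_bounded compact_imp_closed)
  have "hausdorff_dist A B = 0 \<longleftrightarrow> hausdorff_dist A B \<le> 0"
    using hausdorff_dist_nonneg[of A B] by linarith
  also have "\<dots> \<longleftrightarrow> (\<forall>a\<in>A. infdist a B = 0) \<and> (\<forall>b\<in>B. infdist b A = 0)"
    using * by (auto simp: hausdorff_dist_le_iff infdist_nonneg intro: antisym)
  also have "\<dots> \<longleftrightarrow> A = B"
    using * by (auto simp: in_closed_iff_infdist_zero[symmetric])
  finally show "hausdorff_dist A B = 0 \<longleftrightarrow> A = B" .
next
  fix A B C :: "(real ^ 'n) set"
  assume "A \<in> cube_compacts" "B \<in> cube_compacts" "C \<in> cube_compacts"
  then have *: "A \<noteq> {}" "B \<noteq> {}" "C \<noteq> {}" "bounded A" "bounded B" "bounded C"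
    by (auto simp: cube_compacts_def compact_imp_bounded)
  have "infdist a C \<le> hausdorff_dist A B + hausdorff_dist B C" if "a \<in> A" for a
    using infdist_triangle_hausdorff_dist[of B C a] that *
      hausdorff_dist_le_iff[of A B "hausdorff_dist A B"] by fastforce
  moreover have "infdist c A \<le> hausdorff_dist A B + hausdorff_dist B C" if "c \<in> C" for c
    using infdist_triangle_hausdorff_dist[of B A c] that *
      hausdorff_dist_le_iff[of B C "hausdorff_dist B C"] hausdorff_dist_commute[of A B]
    by fastforce
  ultimately show "hausdorff_dist A C \<le> hausdorff_dist A B + hausdorff_dist B C"
    using * by (simp add: hausdorff_dist_le_iff)
qed

lemma zoom_in_cube_compacts:
  assumes "E \<in> cube_compacts" "x \<in> E"
  shows "zoom x t E \<in> cube_compacts"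
proof -
  have "0 \<in> zoom x t E"
    using assms(2) by (force simp: zoom_def cube_def mem_box_cart image_iff)
  moreover have "compact ((\<lambda>y. (1 / t) *\<^sub>R (y - x)) ` E)"
    using assms(1) by (intro compact_continuous_image continuous_intros)
      (simp add: cube_compacts_def)
  then have "compact (zoom x t E)"
    unfolding zoom_def cube_def by (intro compact_Int compact_cbox)
  ultimately show ?thesis by (auto simp: cube_compacts_def zoom_def)
qed

end

(* Replace a finite approximation P of E by the union E' of tiny copies p + s A with p in P, for a
   fixed compact A. Every point of E' lies in one of the copies, so at scale 4 s the zoom of E' at
   any of its points is (A - a) / 4 for some a in A, and all sets close enough to E' look nearly the
   same. Hence, for A in a countable dense family, the sets that do not see A / 4 at small scales
   around each of their points form nowhere dense sets; off their union, compactness of A yields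
   (A - a) / 4 as a tangent set at every point, for every compact A. The factor 1/4, rather than
   1/2, keeps the copy away from the boundary of the cube, where zooming is not stable. *)
theory Submission
  imports Defs
begin

subsection \<open>The Hausdorff distance\<close>

lemma hausdorff_dist_leI:
  assumes "A \<noteq> {}" "B \<noteq> {}" "bounded A" "bounded B"
    and "\<And>a. a \<in> A \<Longrightarrow> \<exists>b\<in>B. dist a b \<le> e"
    and "\<And>b. b \<in> B \<Longrightarrow> \<exists>a\<in>A. dist a b \<le> e"
  shows "hausdorff_dist A B \<le> e"
  unfolding hausdorff_dist_le_iff[OF assms(1-4)]
  using assms(5,6) by (metis dist_commute infdist_le2)

text \<open>Compactness makes \<open>infdist\<close> a minimum, so approximating points exist with
  the distance itself as error, without an extra epsilon.\<close>

lemma hausdorff_dist_attained: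
  fixes A B :: "'a::heine_borel set"
  assumes "compact A" "compact B" "B \<noteq> {}" "a \<in> A"
  shows "\<exists>b\<in>B. dist a b \<le> hausdorff_dist A B"
proof -
  obtain b where "b \<in> B" "infdist a B = dist a b"
    using infdist_attains_inf[of B a] assms by (auto simp: compact_imp_closed)
  moreover have "infdist a B \<le> hausdorff_dist A B"
    using hausdorff_dist_le_iff[of A B "hausdorff_dist A B"] assms compact_imp_bounded by blast
  ultimately show ?thesis by auto
qed

lemma cube_compactsD:
  assumes "A \<in> cube_compacts"
  shows "A \<noteq> {}" "compact A" "bounded A" "A \<subseteq> cube"
  using assms by (auto simp: cube_compacts_def compact_imp_bounded)

lemma mem_cube_iff: "x \<in> cube \<longleftrightarrow> (\<forall>i. \<bar>x $ i\<bar> \<le> 1)"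
  by (auto simp: cube_def mem_box_cart abs_le_iff minus_le_iff)

text \<open>The normalisation \<open>N \<ge> 1\<close> lets \<open>N\<close> absorb bounded additive
  errors later and makes a scale \<open>s\<close> at most \<open>s * N\<close>.\<close>

lemma cube_bounded_ge_1:
  "\<exists>N\<ge>1. \<forall>x\<in>(cube :: (real ^ 'n) set). norm x \<le> N"
proof -
  obtain M where "\<forall>x\<in>(cube :: (real ^ 'n) set). norm x \<le> M"
    using bounded_cbox[of "-1 :: real ^ 'n" 1] unfolding cube_def bounded_iff by blast
  then show ?thesis by (intro exI[of _ "max 1 M"]) force
qed

section \<open>Countable dense sets and approximation by finite sets\<close>

text \<open>The closed cube is the closure of its nonempty interior, so a dense set of interior
  points suffices. Taking the points from the open box leaves room around each of them for a small
  copy inside the cube.\<close>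

lemma countable_dense_cube:
  obtains D :: "(real ^ 'n) set" where
    "countable D" "D \<subseteq> box (-1) 1" "cube \<subseteq> closure D"
proof -
  obtain D :: "(real ^ 'n) set" where
    D: "countable D" "D \<subseteq> box (-1) 1" "box (-1) 1 \<subseteq> closure D"
    using separable by metis
  have "box (-1) (1 :: real ^ 'n) \<noteq> {}"
    by (simp add: interval_ne_empty_cart)
  then have "cube = closure (box (-1) (1 :: real ^ 'n))"
    by (simp add: closure_box cube_def)
  also have "\<dots> \<subseteq> closure D"
    using D(3) closure_minimal by blast
  finally show ?thesis using D that by blast
qed

lemma finite_approximation:
  fixes E :: "(real ^ 'n) set"
  assumes "E \<in> cube_compacts" "D \<subseteq> cube" "cube \<subseteq> closure D" "0 < e"
  obtains P where "finite P" "P \<subseteq> D" "P \<in> cube_compacts" "hausdorff_dist P E \<le> e"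
proof -
  note E = cube_compactsD[OF assms(1)]
  have "E \<subseteq> (\<Union>p\<in>D. ball p e)"
  proof
    fix x assume "x \<in> E"
    then have "x \<in> closure D" using E assms by blast
    then obtain p where "p \<in> D" "dist p x < e"
      using assms(4) closure_approachable by blast
    then show "x \<in> (\<Union>p\<in>D. ball p e)" by auto
  qed
  then obtain C where C: "C \<subseteq> D" "finite C" "E \<subseteq> (\<Union>p\<in>C. ball p e)"
    using compactE_image[OF E(2), of D "\<lambda>p. ball p e"] by (metis open_ball)
  \<comment> \<open>The subcover may contain centres that are far from \<open>E\<close>; these would
    spoil the other half of the Hausdorff estimate and are dropped.\<close>
  define P where "P = {p\<in>C. \<exists>x\<in>E. dist p x < e}"
  have near: "\<exists>p\<in>P. dist p x \<le> e" if "x \<in> E" for x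
    using that C(3) unfolding P_def by force
  have P: "finite P" "P \<subseteq> D" "P \<noteq> {}"
    using C E(1) near unfolding P_def by auto
  have "hausdorff_dist P E \<le> e"
    using P E near by (intro hausdorff_dist_leI) (auto simp: finite_imp_bounded P_def intro: less_imp_le)
  moreover have "P \<in> cube_compacts"
    using P assms(2) by (auto simp: cube_compacts_def finite_imp_compact)
  ultimately show ?thesis using that P by blast
qed

subsection \<open>Zooming in on small copies\<close>

text \<open>The intended \<open>a\<close> is a point of \<open>A\<close>, so that the result
  contains 0. Differences of two points of the cube have coordinates at most 2 in absolute value,
  hence the result stays in the half-size cube.\<close>

definition quarter :: "real ^ 'n \<Rightarrow> (real ^ 'n) set \<Rightarrow> (real ^ 'n) set" where
  "quarter a A = (\<lambda>y. (1 / 4) *\<^sub>R (y - a)) ` A"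

lemma quarter_in_cube_compacts:
  assumes "A \<in> cube_compacts" "a \<in> A"
  shows "quarter a A \<in> cube_compacts"
proof -
  note A = cube_compactsD[OF assms(1)]
  have "compact (quarter a A)"
    unfolding quarter_def using A by (intro compact_continuous_image continuous_intros)
  moreover have "(1 / 4) *\<^sub>R (y - a) \<in> cube" if "y \<in> A" for y
  proof -
    have "\<bar>y $ i\<bar> \<le> 1" "\<bar>a $ i\<bar> \<le> 1" for i
      using that A(4) assms(2) mem_cube_iff by blast+
    then have "\<bar>y $ i - a $ i\<bar> \<le> 4" for i
      using abs_triangle_ineq4[of "y $ i" "a $ i"] \<open>\<bar>y $ i\<bar> \<le> 1\<close> \<open>\<bar>a $ i\<bar> \<le> 1\<close>
      by linarith
    then show ?thesis by (simp add: mem_cube_iff abs_mult)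
  qed
  ultimately show ?thesis
    using assms(2) by (auto simp: cube_compacts_def quarter_def)
qed

text \<open>Joint continuity in the set and the base point: it serves both to replace
  \<open>A\<close> by a nearby set and to pass to a limit of base points.\<close>

lemma hausdorff_dist_quarter_le:
  assumes "A \<in> cube_compacts" "B \<in> cube_compacts" "a \<in> A" "b \<in> B"
  shows "hausdorff_dist (quarter a A) (quarter b B) \<le> (hausdorff_dist A B + dist a b) / 4"
proof -
  note A = cube_compactsD[OF assms(1)] and B = cube_compactsD[OF assms(2)]
  have q: "dist ((1 / 4) *\<^sub>R (y - a)) ((1 / 4) *\<^sub>R (z - b)) \<le> (hausdorff_dist A B + dist a b) / 4"
    if "dist y z \<le> hausdorff_dist A B" for y z
  proof -
    have "(1 / 4) *\<^sub>R (y - a) - (1 / 4) *\<^sub>R (z - b) = (1 / 4) *\<^sub>R ((y - z) - (a - b))"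
      by (simp add: algebra_simps)
    then have "dist ((1 / 4) *\<^sub>R (y - a)) ((1 / 4) *\<^sub>R (z - b)) = norm ((y - z) - (a - b)) / 4"
      by (simp add: dist_norm)
    then show ?thesis
      using norm_triangle_ineq4[of "y - z" "a - b"] that by (simp add: dist_norm)
  qed
  show ?thesis
  proof (rule hausdorff_dist_leI)
    fix v assume "v \<in> quarter a A"
    then obtain y where y: "y \<in> A" "v = (1 / 4) *\<^sub>R (y - a)" by (auto simp: quarter_def)
    then obtain z where "z \<in> B" "dist y z \<le> hausdorff_dist A B"
      using hausdorff_dist_attained[OF A(2) B(2) B(1) y(1)] by blast
    then show "\<exists>w\<in>quarter b B. dist v w \<le> (hausdorff_dist A B + dist a b) / 4"
      using q y unfolding quarter_def by blast
  next
    fix w assume "w \<in> quarter b B"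
    then obtain z where z: "z \<in> B" "w = (1 / 4) *\<^sub>R (z - b)" by (auto simp: quarter_def)
    then obtain y where "y \<in> A" "dist y z \<le> hausdorff_dist A B"
      using hausdorff_dist_attained[OF B(2) A(2) A(1) z(1)] by (auto simp: dist_commute hausdorff_dist_commute)
    then show "\<exists>v\<in>quarter a A. dist v w \<le> (hausdorff_dist A B + dist a b) / 4"
      using q z unfolding quarter_def by blast
  qed (simp_all add: assms cube_compactsD quarter_in_cube_compacts)
qed

text \<open>One number \<open>e\<close> bounds both the scale and the error, so a sequence of values
  tending to 0 controls both. The base point \<open>a\<close> may vary with \<open>x\<close>,
  because the place of \<open>x\<close> within a copy of \<open>A\<close> cannot be
  prescribed.\<close>

definition sees :: "(real ^ 'n) set \<Rightarrow> real \<Rightarrow> (real ^ 'n) set \<Rightarrow> bool" where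
  "sees A e E \<longleftrightarrow> (\<forall>x\<in>E. \<exists>t a. 0 < t \<and> t < e \<and> a \<in> A \<and> hausdorff_dist (zoom x t E) (quarter a A) \<le> e)"

text \<open>Here \<open>E\<close> is \<open>\<eta>\<close>-close to the union of the copies
  \<open>p + s *\<^sub>R A\<close>, and \<open>x\<close> is \<open>\<eta>\<close>-close to a point
  of one copy. Magnified by 1/(4s), the other copies fall outside the window by separation, while
  this copy becomes \<open>quarter a A\<close> up to error.\<close>

lemma hausdorff_dist_zoom_copies_le:
  fixes A P E :: "(real ^ 'n) set"
  assumes A: "A \<in> cube_compacts" and E: "E \<in> cube_compacts"
    and N: "1 \<le> N" "\<And>x :: real ^ 'n. x \<in> cube \<Longrightarrow> norm x \<le> N"
    and s: "0 < s" and eta: "\<eta> \<le> s"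
    and sep: "\<And>p q. p \<in> P \<Longrightarrow> q \<in> P \<Longrightarrow> p \<noteq> q \<Longrightarrow> 10 * s * N < dist p q"
    and ex: "\<And>y. y \<in> E \<Longrightarrow> \<exists>p\<in>P. \<exists>b\<in>A. dist y (p + s *\<^sub>R b) \<le> \<eta>"
    and xe: "\<And>p b. p \<in> P \<Longrightarrow> b \<in> A \<Longrightarrow> \<exists>y\<in>E. dist y (p + s *\<^sub>R b) \<le> \<eta>"
    and x: "x \<in> E" "p \<in> P" "a \<in> A" "dist x (p + s *\<^sub>R a) \<le> \<eta>"
  shows "hausdorff_dist (zoom x (4 * s) E) (quarter a A) \<le> \<eta> / (2 * s)"
proof -
  note Ac = cube_compactsD[OF A]
  \<comment> \<open>An error of at most 1/2 is used twice: to bound the points that can enter the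
    window, and to keep the copy of \<open>A\<close> inside it.\<close>
  have small: "\<eta> / (2 * s) \<le> 1 / 2" using s eta by (simp add: field_simps)
  \<comment> \<open>Both \<open>y\<close> and the centre \<open>x\<close> are displaced by at most
    \<open>\<eta>\<close>; dividing the total 2\<eta> by 4s gives the bound.\<close>
  have near: "dist ((1 / (4 * s)) *\<^sub>R (y - x)) ((1 / (4 * s)) *\<^sub>R (q + s *\<^sub>R b - (p + s *\<^sub>R a))) \<le> \<eta> / (2 * s)"
    if "dist y (q + s *\<^sub>R b) \<le> \<eta>" for y q b
  proof -
    have "dist (y - x) (q + s *\<^sub>R b - (p + s *\<^sub>R a)) \<le> 2 * \<eta>"
      using that x(4) norm_triangle_ineq4[of "y - (q + s *\<^sub>R b)" "x - (p + s *\<^sub>R a)"]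
      by (simp add: dist_norm algebra_simps)
    then have "(1 / (4 * s)) * dist (y - x) (q + s *\<^sub>R b - (p + s *\<^sub>R a)) \<le> (1 / (4 * s)) * (2 * \<eta>)"
      using s by (intro mult_left_mono) auto
    then show ?thesis
      using s by (simp add: dist_norm real_vector.scale_right_diff_distrib[symmetric])
  qed
  have same: "(1 / (4 * s)) *\<^sub>R (p + s *\<^sub>R b - (p + s *\<^sub>R a)) = (1 / 4) *\<^sub>R (b - a)" for b
    using s by (simp add: real_vector.scale_right_diff_distrib)
  show ?thesis
  proof (rule hausdorff_dist_leI)
    fix w assume "w \<in> zoom x (4 * s) E"
    then obtain y where y: "y \<in> E" "w = (1 / (4 * s)) *\<^sub>R (y - x)" "w \<in> cube"
      by (auto simp: zoom_def)
    obtain q b where qb: "q \<in> P" "b \<in> A" "dist y (q + s *\<^sub>R b) \<le> \<eta>" using ex y by blast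
    define v where "v = q + s *\<^sub>R b - (p + s *\<^sub>R a)"
    have wv: "dist w ((1 / (4 * s)) *\<^sub>R v) \<le> \<eta> / (2 * s)"
      using near[OF qb(3)] y by (simp add: v_def)
    have "norm ((1 / (4 * s)) *\<^sub>R v) \<le> norm w + dist w ((1 / (4 * s)) *\<^sub>R v)"
      unfolding dist_norm by (metis norm_triangle_sub norm_minus_commute)
    also have "\<dots> \<le> 2 * N" using N(1) N(2)[OF y(3)] wv small by linarith
    finally have "norm v \<le> 8 * s * N" using s by (simp add: field_simps)
    moreover have "norm b \<le> N" "norm a \<le> N" using Ac(4) qb(2) x(3) N(2) by blast+
    then have "norm (s *\<^sub>R b) \<le> s * N" "norm (s *\<^sub>R a) \<le> s * N" using s by auto
    moreover have "q - p = v - s *\<^sub>R b + s *\<^sub>R a" by (simp add: v_def)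
    then have "norm (q - p) \<le> norm v + norm (s *\<^sub>R b) + norm (s *\<^sub>R a)"
      using norm_triangle_ineq[of "v - s *\<^sub>R b" "s *\<^sub>R a"] norm_triangle_ineq4[of v "s *\<^sub>R b"]
      by simp
    \<comment> \<open>The constant 10 is 8 for the magnified window plus 1 for each of the offsets
      of \<open>a\<close> and \<open>b\<close> inside their copies.\<close>
    ultimately have "dist p q \<le> 10 * s * N" by (simp add: dist_norm norm_minus_commute)
    then have "q = p" using sep[of p q] qb x by fastforce
    then have "dist w ((1 / 4) *\<^sub>R (b - a)) \<le> \<eta> / (2 * s)" using wv same by (simp add: v_def)
    then show "\<exists>z\<in>quarter a A. dist w z \<le> \<eta> / (2 * s)" using qb(2) by (auto simp: quarter_def)
  next
    fix z assume "z \<in> quarter a A"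
    then obtain b where b: "b \<in> A" "z = (1 / 4) *\<^sub>R (b - a)" by (auto simp: quarter_def)
    obtain y where y: "y \<in> E" "dist y (p + s *\<^sub>R b) \<le> \<eta>" using xe b x by blast
    define w where "w = (1 / (4 * s)) *\<^sub>R (y - x)"
    have wz: "dist w z \<le> \<eta> / (2 * s)" using near[OF y(2)] same b by (simp add: w_def)
    \<comment> \<open>Half of the window is left as margin by \<open>quarter\<close>, and the error
      uses up at most the other half, so \<open>w\<close> is not cut off by the intersection with
      the cube.\<close>
    have "\<bar>w $ i\<bar> \<le> 1" for i
    proof -
      have "\<bar>b $ i\<bar> \<le> 1" "\<bar>a $ i\<bar> \<le> 1"
        using Ac(4) b x mem_cube_iff by blast+
      then have "\<bar>z $ i\<bar> \<le> 1 / 2" by (simp add: b(2) abs_le_iff)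
      moreover have "\<bar>w $ i - z $ i\<bar> \<le> 1 / 2"
        using component_le_norm_cart[of "w - z" i] wz small by (simp add: dist_norm)
      ultimately show ?thesis by linarith
    qed
    then have "w \<in> zoom x (4 * s) E"
      using y by (auto simp: zoom_def w_def mem_cube_iff)
    then show "\<exists>w\<in>zoom x (4 * s) E. dist w z \<le> \<eta> / (2 * s)" using wz by blast
  qed (simp_all add: A E x cube_compactsD quarter_in_cube_compacts zoom_in_cube_compacts)
qed

section \<open>Failing to see a given set is a nowhere dense property\<close>

text \<open>A finite set \<open>P\<close> near \<open>E\<close> is thickened to a union of tiny
  disjoint copies of \<open>A\<close>. The estimate for zooms tolerates a perturbation of size
  \<open>\<eta>\<close>, so a whole ball around the new set consists of sets seeing
  \<open>A\<close>.\<close>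

lemma sees_dense_interior:
  fixes A E :: "(real ^ 'n) set"
  assumes A: "A \<in> cube_compacts" and E: "E \<in> cube_compacts" and "0 < e" "0 < r"
  obtains E' \<eta> where "E' \<in> cube_compacts" "hausdorff_dist E E' < r" "0 < \<eta>"
    "\<And>F. F \<in> cube_compacts \<Longrightarrow> hausdorff_dist E' F < \<eta> \<Longrightarrow> sees A e F"
proof -
  interpret K: Metric_space "cube_compacts :: (real ^ 'n) set set" hausdorff_dist
    by (rule Metric_space_cube_compacts)
  note Ac = cube_compactsD[OF A]
  obtain N where "1 \<le> N" "\<forall>x\<in>(cube :: (real ^ 'n) set). norm x \<le> N"
    using cube_bounded_ge_1 by blast
  then have N: "1 \<le> N" "\<And>x :: real ^ 'n. x \<in> cube \<Longrightarrow> norm x \<le> N" by auto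
  obtain D :: "(real ^ 'n) set" where "countable D" and D: "D \<subseteq> box (-1) 1" "cube \<subseteq> closure D"
    by (rule countable_dense_cube)
  have Dc: "D \<subseteq> cube" using D(1) box_subset_cbox unfolding cube_def by blast
  obtain P where P: "finite P" "P \<subseteq> D" "P \<in> cube_compacts" "hausdorff_dist P E \<le> r / 2"
    using finite_approximation[OF E Dc D(2) half_gt_zero[OF \<open>0 < r\<close>]] by blast
  have Pn: "P \<noteq> {}" using cube_compactsD(1)[OF P(3)] .
  \<comment> \<open>Finitely many interior points admit one common radius.\<close>
  have "\<exists>\<delta>>0. \<forall>p\<in>P. cball p \<delta> \<subseteq> cube"
  proof -
    have "\<forall>p\<in>P. \<exists>\<delta>>0. cball p \<delta> \<subseteq> box (-1) 1"
      using P(2) D(1) open_contains_cball[of "box (-1) (1 :: real ^ 'n)"] open_box by blast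
    then obtain \<delta> where \<delta>: "\<forall>p\<in>P. 0 < \<delta> p \<and> cball p (\<delta> p) \<subseteq> box (-1) 1" by metis
    have "cball p (Min (\<delta> ` P)) \<subseteq> cube" if "p \<in> P" for p
    proof -
      have "Min (\<delta> ` P) \<le> \<delta> p" using P(1) that by simp
      then show ?thesis using \<delta> that box_subset_cbox unfolding cube_def
        by (meson order_trans subset_cball)
    qed
    moreover have "0 < Min (\<delta> ` P)" using \<delta> P(1) Pn by simp
    ultimately show ?thesis by blast
  qed
  then obtain \<delta> where \<delta>: "0 < \<delta>" "\<And>p. p \<in> P \<Longrightarrow> cball p \<delta> \<subseteq> cube" by blast
  obtain \<sigma> where \<sigma>: "0 < \<sigma>" "\<And>p q. p \<in> P \<Longrightarrow> q \<in> P \<Longrightarrow> p \<noteq> q \<Longrightarrow> \<sigma> \<le> dist p q"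
  proof -
    have "\<forall>p\<in>P. \<exists>d>0. \<forall>q\<in>P. q \<noteq> p \<longrightarrow> d \<le> dist p q"
      using finite_set_avoid[OF P(1)] by blast
    then obtain f where f: "\<forall>p\<in>P. 0 < f p \<and> (\<forall>q\<in>P. q \<noteq> p \<longrightarrow> f p \<le> dist p q)" by metis
    have "0 < Min (f ` P)" using f P(1) Pn by simp
    moreover have "Min (f ` P) \<le> dist p q" if "p \<in> P" "q \<in> P" "p \<noteq> q" for p q
      using f P(1) that by (metis Min_le finite_imageI imageI order_trans)
    ultimately show ?thesis using that by blast
  qed
  \<comment> \<open>A copy has radius at most \<open>s * N\<close>. The four bounds keep copies in
    the cube, force separation beyond \<open>10 * s * N\<close>, keep \<open>E'\<close> within r/2 +
    r/4 of \<open>E\<close>, and make the zoom scale 4s smaller than \<open>e\<close>.\<close>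
  define s where "s = Min {\<delta>, \<sigma> / 11, r / 4, e / 5} / N"
  have s: "0 < s" "s * N \<le> \<delta>" "11 * (s * N) \<le> \<sigma>" "s * N \<le> r / 4" "5 * (s * N) \<le> e"
    using N \<delta>(1) \<sigma>(1) assms(3,4) by (auto simp: s_def min_def)
  have sN: "s \<le> s * N" "0 < s * N" using s(1) N(1) by auto
  \<comment> \<open>The first bound is the hypothesis of the zoom estimate; the second turns its
    error \<open>\<eta> / (2 * s)\<close> into at most \<open>e\<close>.\<close>
  define \<eta> where "\<eta> = min s (2 * s * e)"
  have \<eta>: "0 < \<eta>" "\<eta> \<le> s" "\<eta> / (2 * s) \<le> e"
    using s(1) \<open>0 < e\<close> by (auto simp: \<eta>_def field_simps min_def)
  define E' where "E' = (\<Union>p\<in>P. (\<lambda>b. p + s *\<^sub>R b) ` A)"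
  have shift: "dist p (p + s *\<^sub>R b) \<le> s * N" if "b \<in> A" for p b
    using that Ac(4) N(2)[of b] s(1) by (auto simp: dist_norm)
  have E': "E' \<in> cube_compacts"
  proof -
    have "compact E'" unfolding E'_def
      using P(1) Ac(2) by (intro compact_UN compact_continuous_image continuous_intros) auto
    moreover have "E' \<subseteq> cube"
    proof -
      have "p + s *\<^sub>R b \<in> cube" if "p \<in> P" "b \<in> A" for p b
        using shift[OF that(2), of p] s(2) \<delta>(2)[OF that(1)] by (auto simp: subset_iff)
      then show ?thesis unfolding E'_def by auto
    qed
    moreover have "E' \<noteq> {}" using Pn Ac(1) by (auto simp: E'_def)
    ultimately show ?thesis by (simp add: cube_compacts_def)
  qed
  have "hausdorff_dist P E' \<le> s * N"
  proof (rule hausdorff_dist_leI)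
    fix p assume "p \<in> P"
    moreover obtain b where "b \<in> A" using Ac(1) by blast
    ultimately show "\<exists>y\<in>E'. dist p y \<le> s * N" using shift unfolding E'_def by blast
  next
    fix y assume "y \<in> E'"
    then show "\<exists>p\<in>P. dist p y \<le> s * N" using shift unfolding E'_def by blast
  qed (simp_all add: P(3) E' cube_compactsD)
  then have "hausdorff_dist E E' < r"
    using K.triangle[OF E P(3) E'] P(4) s(4) \<open>0 < r\<close> by (simp add: hausdorff_dist_commute)
  moreover have "sees A e F" if F: "F \<in> cube_compacts" "hausdorff_dist E' F < \<eta>" for F
    unfolding sees_def
  proof
    fix x assume x: "x \<in> F"
    have ex: "\<exists>p\<in>P. \<exists>b\<in>A. dist y (p + s *\<^sub>R b) \<le> \<eta>" if y: "y \<in> F" for y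
    proof -
      have "\<exists>z\<in>E'. dist y z \<le> hausdorff_dist F E'"
        using hausdorff_dist_attained[of F E' y] F(1) E' y by (simp add: cube_compactsD)
      then show ?thesis using F(2) unfolding E'_def by (force simp: hausdorff_dist_commute)
    qed
    have xe: "\<exists>y\<in>F. dist y (p + s *\<^sub>R b) \<le> \<eta>" if pb: "p \<in> P" "b \<in> A" for p b
    proof -
      have "p + s *\<^sub>R b \<in> E'" using pb by (auto simp: E'_def)
      then have "\<exists>y\<in>F. dist (p + s *\<^sub>R b) y \<le> hausdorff_dist E' F"
        using hausdorff_dist_attained[of E' F] F(1) E' by (simp add: cube_compactsD)
      then show ?thesis using F(2) by (force simp: dist_commute)
    qed
    have sep: "10 * s * N < dist p q" if "p \<in> P" "q \<in> P" "p \<noteq> q" for p q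
      using \<sigma>(2)[OF that] s(3) sN by linarith
    obtain p a where pa: "p \<in> P" "a \<in> A" "dist x (p + s *\<^sub>R a) \<le> \<eta>" using ex x by blast
    have "hausdorff_dist (zoom x (4 * s) F) (quarter a A) \<le> \<eta> / (2 * s)"
      by (rule hausdorff_dist_zoom_copies_le[OF A F(1) N s(1) \<eta>(2) sep ex xe x pa])
    moreover have "0 < 4 * s" "4 * s < e" using s(1,5) sN by linarith+
    ultimately show "\<exists>t a. 0 < t \<and> t < e \<and> a \<in> A \<and> hausdorff_dist (zoom x t F) (quarter a A) \<le> e"
      using pa(2) \<eta>(3) by (meson order_trans)
  qed
  ultimately show ?thesis using that E' \<eta>(1) by blast
qed

text \<open>A ball inside the closure would contain some \<open>E'\<close> with a neighbourhood of
  sets seeing \<open>A\<close>, which \<open>S\<close> cannot meet. Arbitrary subsets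
  \<open>S\<close> are allowed because the exceptional set must later be exactly a union of such
  pieces.\<close>

lemma not_sees_nowhere_dense:
  fixes A :: "(real ^ 'n) set"
  defines "X \<equiv> Metric_space.mtopology (cube_compacts :: (real ^ 'n) set set) hausdorff_dist"
  assumes "A \<in> cube_compacts" "0 < e" "S \<subseteq> {E \<in> cube_compacts. \<not> sees A e E}"
  shows "X interior_of (X closure_of S) = {}"
proof (rule ccontr)
  interpret K: Metric_space "cube_compacts :: (real ^ 'n) set set" hausdorff_dist
    by (rule Metric_space_cube_compacts)
  assume "\<not> ?thesis"
  then obtain E where "E \<in> X interior_of (X closure_of S)" by blast
  then obtain r where r: "E \<in> cube_compacts" "0 < r" "K.mball E r \<subseteq> X closure_of S"
    unfolding X_def K.metric_interior_of by auto
  then obtain E' \<eta> where E': "E' \<in> cube_compacts" "hausdorff_dist E E' < r" "0 < \<eta>"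
    "\<And>F. F \<in> cube_compacts \<Longrightarrow> hausdorff_dist E' F < \<eta> \<Longrightarrow> sees A e F"
    using sees_dense_interior[OF assms(2) r(1) assms(3) r(2)] by metis
  then have "E' \<in> K.mtopology closure_of S"
    using r by (auto simp: X_def)
  then obtain F where "F \<in> S" "F \<in> K.mball E' \<eta>"
    using E'(3) unfolding K.metric_closure_of by blast
  then show False using E'(4) assms(4) by auto
qed

subsection \<open>Tangent sets of sets that see a dense family\<close>

text \<open>The base points found at smaller and smaller scales lie in the compact set
  \<open>A\<close>; along a convergent subsequence the sets \<open>quarter\<close> of them converge
  to that of the limit point.\<close>

lemma quarter_tangent_set:
  fixes A E :: "(real ^ 'n) set"
  assumes A: "A \<in> cube_compacts" and E: "E \<in> cube_compacts" and x: "x \<in> E"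
    and sees: "\<And>e. 0 < e \<Longrightarrow>
      \<exists>t a. 0 < t \<and> t < e \<and> a \<in> A \<and> hausdorff_dist (zoom x t E) (quarter a A) \<le> e"
  obtains a where "a \<in> A" "quarter a A \<in> tangent_sets E x"
proof -
  interpret K: Metric_space "cube_compacts :: (real ^ 'n) set set" hausdorff_dist
    by (rule Metric_space_cube_compacts)
  note Ac = cube_compactsD[OF A]
  define e :: "nat \<Rightarrow> real" where "e n = inverse (real (Suc n))" for n
  have e: "0 < e n" for n by (simp add: e_def)
  have e0: "e \<longlonglongrightarrow> 0" unfolding e_def by (rule LIMSEQ_inverse_real_of_nat)
  define ok where "ok n ta \<longleftrightarrow> 0 < fst ta \<and> fst ta \<le> e n \<and> snd ta \<in> A \<and>
    hausdorff_dist (zoom x (fst ta) E) (quarter (snd ta) A) \<le> e n" for n and ta :: "real \<times> (real ^ 'n)"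
  have ok: "\<exists>ta. ok n ta \<and> fst ta \<le> m" if m: "0 < m" for n m
  proof -
    obtain t a where "0 < t" "t < min m (e n)" "a \<in> A"
      "hausdorff_dist (zoom x t E) (quarter a A) \<le> min m (e n)"
      using sees[of "min m (e n)"] m e[of n] by auto
    then have "ok n (t, a) \<and> fst (t, a) \<le> m" by (simp add: ok_def)
    then show ?thesis by blast
  qed
  \<comment> \<open>Dependent choice makes the scales decrease, as \<open>tangent_sets\<close>
    demands; tending to 0 alone would not be enough.\<close>
  have "\<exists>f. \<forall>n. ok n (f n) \<and> fst (f (Suc n)) \<le> fst (f n)"
  proof (rule dependent_nat_choice)
    show "\<exists>ta. ok 0 ta" using ok[of 1 0] zero_less_one by blast
  next
    fix ta n assume "ok n ta"
    then show "\<exists>tb. ok (Suc n) tb \<and> fst tb \<le> fst ta" using ok by (simp add: ok_def)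
  qed
  then obtain f where f: "\<And>n. ok n (f n)" "\<And>n. fst (f (Suc n)) \<le> fst (f n)" by blast
  have dec: "decseq (\<lambda>n. fst (f n))" using f(2) by (rule decseq_SucI)
  have t0: "(\<lambda>n. fst (f n)) \<longlonglongrightarrow> 0"
    using f(1) by (intro tendsto_sandwich[OF _ _ tendsto_const e0] always_eventually)
      (auto simp: ok_def intro: less_imp_le)
  have "\<forall>n. snd (f n) \<in> A" using f(1) by (simp add: ok_def)
  then obtain a r where a: "a \<in> A" and r: "strict_mono r" and lim: "((\<lambda>n. snd (f n)) \<circ> r) \<longlonglongrightarrow> a"
    using Ac(2) unfolding compact_def by metis
  have q: "quarter a A \<in> cube_compacts" by (rule quarter_in_cube_compacts[OF A a])
  have bound: "hausdorff_dist (zoom x (fst (f (r n))) E) (quarter a A) \<le> e (r n) + dist (snd (f (r n))) a" for n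
  proof -
    have m: "snd (f (r n)) \<in> A" using f(1) by (simp add: ok_def)
    have "hausdorff_dist (quarter (snd (f (r n))) A) (quarter a A) \<le> dist (snd (f (r n))) a"
      using hausdorff_dist_quarter_le[OF A A m a] K.mdist_zero[OF A] by (simp add: field_simps)
        (smt (verit) zero_le_dist)
    moreover have "hausdorff_dist (zoom x (fst (f (r n))) E) (quarter (snd (f (r n))) A) \<le> e (r n)"
      using f(1) by (simp add: ok_def)
    ultimately show ?thesis
      using K.triangle[OF zoom_in_cube_compacts[OF E x] quarter_in_cube_compacts[OF A m] q,
          of "fst (f (r n))"] by linarith
  qed
  have "(\<lambda>n. e (r n) + dist (snd (f (r n))) a) \<longlonglongrightarrow> 0 + 0"
    using LIMSEQ_subseq_LIMSEQ[OF e0 r] lim[THEN tendsto_dist_iff[THEN iffD1]]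
    by (intro tendsto_add) (simp_all add: o_def)
  then have "(\<lambda>n. hausdorff_dist (zoom x (fst (f (r n))) E) (quarter a A)) \<longlonglongrightarrow> 0"
    unfolding add_0
    by (rule Lim_null_comparison[rotated]) (simp add: bound hausdorff_dist_nonneg)
  moreover have "(\<lambda>n. fst (f (r n))) \<longlonglongrightarrow> 0" using LIMSEQ_subseq_LIMSEQ[OF t0 r] by (simp add: o_def)
  moreover have "decseq (\<lambda>n. fst (f (r n)))"
    using dec strict_mono_mono[OF r] by (auto simp: decseq_def mono_def)
  moreover have "0 < fst (f (r n))" for n using f(1) by (simp add: ok_def)
  ultimately have "quarter a A \<in> tangent_sets E x"
    unfolding tangent_sets_def using q by (auto intro!: exI[of _ "\<lambda>n. fst (f (r n))"])
  then show ?thesis using that a by blast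
qed

text \<open>A member \<open>B\<close> of the family close to \<open>A\<close> is seen at small
  scale; its base point is moved to a nearby point of \<open>A\<close>.\<close>

lemma sees_dense_family:
  fixes A E :: "(real ^ 'n) set"
  assumes A: "A \<in> cube_compacts" and E: "E \<in> cube_compacts" and x: "x \<in> E"
    and fam: "\<F> \<subseteq> cube_compacts" "\<And>e. 0 < e \<Longrightarrow> \<exists>B\<in>\<F>. hausdorff_dist B A \<le> e"
    and sees: "\<And>B n. B \<in> \<F> \<Longrightarrow> sees B (inverse (real (Suc n))) E"
    and "0 < e"
  shows "\<exists>t a. 0 < t \<and> t < e \<and> a \<in> A \<and> hausdorff_dist (zoom x t E) (quarter a A) \<le> e"
proof -
  interpret K: Metric_space "cube_compacts :: (real ^ 'n) set set" hausdorff_dist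
    by (rule Metric_space_cube_compacts)
  obtain B where B: "B \<in> \<F>" "hausdorff_dist B A \<le> e / 2" using fam(2)[of "e / 2"] \<open>0 < e\<close> by auto
  have Bc: "B \<in> cube_compacts" using B fam by blast
  obtain n where n: "inverse (real (Suc n)) < e / 2"
    using reals_Archimedean[of "e / 2"] \<open>0 < e\<close> by auto
  obtain t b where t: "0 < t" "t < inverse (real (Suc n))" "b \<in> B"
    "hausdorff_dist (zoom x t E) (quarter b B) \<le> inverse (real (Suc n))"
    using sees[OF B(1), of n] x unfolding sees_def by blast
  obtain a where a: "a \<in> A" "dist b a \<le> hausdorff_dist B A"
    using hausdorff_dist_attained[of B A b] t(3) A Bc by (auto simp: cube_compactsD)
  \<comment> \<open>Both the change of set and the change of base point cost at most e/2, and
    \<open>quarter\<close> divides the sum by 4.\<close>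
  have "hausdorff_dist (quarter b B) (quarter a A) \<le> e / 2"
    using hausdorff_dist_quarter_le[OF Bc A t(3) a(1)] a(2) B(2) \<open>0 < e\<close>
    by (simp add: field_simps)
  then have "hausdorff_dist (zoom x t E) (quarter a A) \<le> e"
    using K.triangle[OF zoom_in_cube_compacts[OF E x] quarter_in_cube_compacts[OF Bc t(3)]
        quarter_in_cube_compacts[OF A a(1)], of t] t(4) n by linarith
  then show ?thesis using t n a \<open>0 < e\<close> by (intro exI[of _ t] exI[of _ a]) linarith
qed

section \<open>From tangent sets to local richness\<close>

text \<open>Tangent sets are themselves members of \<open>cube_compacts\<close>, so one comparison
  holds with factor 1. For the other, \<open>quarter a A\<close> is a copy of \<open>A\<close> with
  factor 1/4, based at \<open>a\<close> on one side and 0 on the other.\<close>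

lemma locally_richI:
  fixes E :: "(real ^ 'n) set"
  assumes "\<And>x A. x \<in> E \<Longrightarrow> A \<in> cube_compacts \<Longrightarrow> \<exists>a\<in>A. quarter a A \<in> tangent_sets E x"
  shows "locally_rich E"
proof -
  have "coll_lesssim (tangent_sets E x) cube_compacts" for x
    unfolding coll_lesssim_def
  proof (intro exI[of _ "1 / 2"] conjI ballI)
    fix F assume "F \<in> tangent_sets E x"
    then have F: "F \<in> cube_compacts" by (simp add: tangent_sets_def)
    then obtain a where "a \<in> F" using cube_compactsD by blast
    then show "\<exists>B\<in>cube_compacts. \<exists>l :: real. 1 / 2 < l \<and> l < inverse (1 / 2) \<and>
      (\<exists>a\<in>F. \<exists>b\<in>B. (\<lambda>y. l *\<^sub>R (y - a)) ` F = (\<lambda>y. y - b) ` B)"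
      using F by (intro bexI[of _ F] exI[of _ 1]) auto
  qed simp
  moreover have "coll_lesssim cube_compacts (tangent_sets E x)" if x: "x \<in> E" for x
    unfolding coll_lesssim_def
  proof (intro exI[of _ "1 / 8"] conjI ballI)
    fix A :: "(real ^ 'n) set" assume "A \<in> cube_compacts"
    then obtain a where a: "a \<in> A" "quarter a A \<in> tangent_sets E x" using assms x by blast
    have "0 \<in> quarter a A" using a(1) by (auto simp: quarter_def image_iff intro!: bexI[of _ a])
    moreover have "(\<lambda>y. (1 / 4) *\<^sub>R (y - a)) ` A = (\<lambda>y. y - 0) ` quarter a A"
      by (simp add: quarter_def)
    ultimately show "\<exists>B\<in>tangent_sets E x. \<exists>l :: real. 1 / 8 < l \<and> l < inverse (1 / 8) \<and>
      (\<exists>a\<in>A. \<exists>b\<in>B. (\<lambda>y. l *\<^sub>R (y - a)) ` A = (\<lambda>y. y - b) ` B)"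
      using a by (intro bexI[of _ "quarter a A"] exI[of _ "1 / 4"] conjI bexI[of _ a] bexI[of _ 0]) auto
  qed simp
  ultimately show ?thesis by (simp add: locally_rich_def coll_approx_def)
qed

theorem theorem3p6:
  shows "first_category_in
    (Metric_space.mtopology (cube_compacts :: (real ^ 'n) set set) hausdorff_dist)
    {E \<in> cube_compacts. \<not> locally_rich E}"
proof -
  interpret K: Metric_space "cube_compacts :: (real ^ 'n) set set" hausdorff_dist
    by (rule Metric_space_cube_compacts)
  obtain D :: "(real ^ 'n) set" where D: "countable D" "D \<subseteq> box (-1) 1" "cube \<subseteq> closure D"
    by (rule countable_dense_cube)
  have Dc: "D \<subseteq> cube" using D(2) box_subset_cbox unfolding cube_def by blast
  \<comment> \<open>Finite subsets of a countable set form a countable family, dense by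
    \<open>finite_approximation\<close>.\<close>
  define \<F> where "\<F> = {B \<in> cube_compacts. finite B \<and> B \<subseteq> D}"
  have cF: "countable \<F>"
    by (rule countable_subset[OF _ countable_Collect_finite_subset[OF D(1)]]) (auto simp: \<F>_def)
  define S where "S = {E \<in> (cube_compacts :: (real ^ 'n) set set). \<not> locally_rich E}"
  \<comment> \<open>Each piece is cut down to \<open>S\<close>, since
    \<open>first_category_in\<close> asks for equality with the union and not just for a
    cover.\<close>
  define bad where "bad = (\<lambda>(B, n). {E \<in> S. \<not> sees B (inverse (real (Suc n))) E})"
  have "S \<subseteq> \<Union> (bad ` (\<F> \<times> UNIV))"
  proof
    fix E assume ES: "E \<in> S"
    then have E: "E \<in> cube_compacts" "\<not> locally_rich E" by (auto simp: S_def)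
    show "E \<in> \<Union> (bad ` (\<F> \<times> UNIV))"
    proof (rule ccontr)
      assume "\<not> ?thesis"
      then have sees: "sees B (inverse (real (Suc n))) E" if "B \<in> \<F>" for B n
        using that ES by (auto simp: bad_def)
      have "\<exists>a\<in>A. quarter a A \<in> tangent_sets E x" if x: "x \<in> E" and A: "A \<in> cube_compacts" for x A
      proof -
        have "\<exists>B\<in>\<F>. hausdorff_dist B A \<le> e" if "0 < e" for e
          using finite_approximation[OF A Dc D(3) that] unfolding \<F>_def by blast
        then have "\<exists>t a. 0 < t \<and> t < e \<and> a \<in> A \<and> hausdorff_dist (zoom x t E) (quarter a A) \<le> e"
          if "0 < e" for e
          using sees_dense_family[OF A E(1) x, of \<F>] sees that by (auto simp: \<F>_def)
        then show ?thesis using quarter_tangent_set[OF A E(1) x] by metis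
      qed
      then show False using locally_richI E(2) by blast
    qed
  qed
  then have "S = \<Union> (bad ` (\<F> \<times> UNIV))" by (auto simp: bad_def)
  moreover have "N \<subseteq> topspace K.mtopology \<and> K.mtopology interior_of (K.mtopology closure_of N) = {}"
    if N: "N \<in> bad ` (\<F> \<times> UNIV)" for N
  proof -
    obtain B n where B: "B \<in> \<F>" "N = {E \<in> S. \<not> sees B (inverse (real (Suc n))) E}"
      using N by (auto simp: bad_def)
    then have "K.mtopology interior_of (K.mtopology closure_of N) = {}"
      by (intro not_sees_nowhere_dense[of B "inverse (real (Suc n))"]) (auto simp: \<F>_def S_def)
    then show ?thesis using B by (auto simp: S_def)
  qed
  moreover have "countable (bad ` (\<F> \<times> UNIV))" using cF by auto
  ultimately show ?thesis unfolding first_category_in_def S_def[symmetric]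
    by (intro exI[of _ "bad ` (\<F> \<times> UNIV)"]) simp
qed

end
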